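(* Let $H$ be a Hilbert space. Then the class $\mathcal{C}_{DC}(H)$ of all demicontractive mappings $T:H\to H$ is a saturated class of mappings, i.e. $\mathcal{C}_{DC}(H)=\mathcal{C}_{DC}^{e}(H)$.
   Context: For a self mapping $T:X\to X$ of a linear normed space $(X,\|\cdot\|)$ and $\lambda\in(0,1]$, the averaged mapping $T_\lambda:X\to X$ is $T_\lambda x=(1-\lambda)x+\lambda Tx$. If $\mathcal{C}$ is a subset of the family of all self mappings of $X$, a mapping $T:X\to X$ is called $\mathcal{C}$-enriched if there exists $\lambda\in(0,1]$ such that $T_\lambda\in\mathcal{C}$; $\mathcal{C}^{e}$ denotes the set of all $\mathcal{C}$-enriched mappings. One always has $\mathcal{C}\subseteq\mathcal{C}^{e}$ (take $\lambda=1$). The class $\mathcal{C}$ is called unsaturated if the inclusion $\mathcal{C}\subset\mathcal{C}^{e}$ is strict, and saturated if $\mathcal{C}=\mathcal{C}^{e}$. Write $Fix(T)=\{a\in X: Ta=a\}$. A mapping $T:X\to X$ is demicontractive if $Fix(T)\neq\emptyset$ and there exists a real number $k<1$ such that $\|Tx-y^*\|^2\le\|x-y^*\|^2+k\,\|x-Tx\|^2$ for all $x\in X$ and all $y^*\in Fix(T)$. $\mathcal{C}_{DC}(X)$ denotes the class of all demicontractive mappings on $X$, and $\mathcal{C}_{DC}^{e}(X)=(\mathcal{C}_{DC}(X))^{e}$. *)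

theory Defs
  imports "HOL-Analysis.Analysis"
begin

definition averaged :: "real \<Rightarrow> ('a::real_normed_vector \<Rightarrow> 'a) \<Rightarrow> 'a \<Rightarrow> 'a" where
  "averaged l T x = (1 - l) *\<^sub>R x + l *\<^sub>R T x"

definition enriched :: "('a::real_normed_vector \<Rightarrow> 'a) set \<Rightarrow> ('a \<Rightarrow> 'a) set" where
  "enriched C = {T. \<exists>l\<in>{0<..1}. averaged l T \<in> C}"

definition saturated :: "('a::real_normed_vector \<Rightarrow> 'a) set \<Rightarrow> bool" where
  "saturated C \<longleftrightarrow> C = enriched C"

definition Fix :: "('a \<Rightarrow> 'a) \<Rightarrow> 'a set" where
  "Fix T = {a. T a = a}"

(* The constant k is uniform in x and y and may be negative. *)
definition demicontractive :: "('a::real_normed_vector \<Rightarrow> 'a) \<Rightarrow> bool" where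
  "demicontractive T \<longleftrightarrow> Fix T \<noteq> {} \<and>
     (\<exists>k<1. \<forall>x. \<forall>y\<in>Fix T.
        (norm (T x - y))\<^sup>2 \<le> (norm (x - y))\<^sup>2 + k * (norm (x - T x))\<^sup>2)"

definition C_DC :: "('a::real_normed_vector \<Rightarrow> 'a) set" where
  "C_DC = {T. demicontractive T}"

end

(* With d = x - y and e = x - T x, the demicontractive inequality
   |d - e|^2 <= |d|^2 + k |e|^2 expands to (1 - k) |e|^2 <= 2 <d, e>.
   Averaging fixes the same points and replaces e by l e, so it only rescales the
   constant 1 - k > 0: if the averaged map satisfies the inequality with k, then T
   satisfies it with 1 - (1 - k) l < 1. *)

theory Submission
  imports Defs
begin

lemma averaged_1 [simp]: "averaged 1 T = T"
  by (rule ext) (simp add: averaged_def)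

lemma diff_averaged: "x - averaged l T x = l *\<^sub>R (x - T x)"
  by (simp add: averaged_def algebra_simps)

lemma Fix_averaged:
  assumes "l \<noteq> 0"
  shows "Fix (averaged l T) = Fix T"
proof -
  have "averaged l T x = x \<longleftrightarrow> T x = x" for x
    using diff_averaged[of x l T] assms by (metis eq_iff_diff_eq_0 scaleR_eq_0_iff)
  then show ?thesis
    by (simp add: Fix_def)
qed

text \<open>Expand the square of \<open>z - y = (x - y) - (x - z)\<close>. In the new form
  \<open>x - z\<close> enters quadratically on the left and linearly on the right, so scaling it by
  a positive factor changes only the constant.\<close>

lemma demicontractive_ineq_iff:
  fixes x y z :: "'a::real_inner"
  shows "(norm (z - y))\<^sup>2 \<le> (norm (x - y))\<^sup>2 + k * (norm (x - z))\<^sup>2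
    \<longleftrightarrow> (1 - k) * (norm (x - z))\<^sup>2 \<le> 2 * ((x - y) \<bullet> (x - z))"
proof -
  have "(norm (z - y))\<^sup>2 = (norm ((x - y) - (x - z)))\<^sup>2"
    by simp
  also have "\<dots> = (norm (x - y))\<^sup>2 - 2 * ((x - y) \<bullet> (x - z)) + (norm (x - z))\<^sup>2"
    unfolding power2_norm_eq_inner by (simp only: inner_diff inner_commute) simp
  finally show ?thesis
    by (auto simp: algebra_simps)
qed

lemma demicontractive_averagedD:
  fixes T :: "'a::real_inner \<Rightarrow> 'a"
  assumes "demicontractive (averaged l T)" and "l > 0"
  shows "demicontractive T"
proof -
  have Fix: "Fix (averaged l T) = Fix T"
    using \<open>l > 0\<close> by (simp add: Fix_averaged)
  obtain k where "k < 1" and k: "\<And>x y. y \<in> Fix T \<Longrightarrow>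
      (1 - k) * (norm (x - averaged l T x))\<^sup>2 \<le> 2 * ((x - y) \<bullet> (x - averaged l T x))"
    using assms(1) unfolding demicontractive_def demicontractive_ineq_iff Fix by blast
  \<comment> \<open>The coefficient is just \<open>(1 - k) * l\<close>; written this way it has the
    shape \<open>1 - k'\<close> with the new constant \<open>k' = 1 - (1 - k) * l\<close>.\<close>
  have "(1 - (1 - (1 - k) * l)) * (norm (x - T x))\<^sup>2 \<le> 2 * ((x - y) \<bullet> (x - T x))"
    if "y \<in> Fix T" for x y
  proof -
    \<comment> \<open>The displacement of the averaged map is \<open>l *\<^sub>R (x - T x)\<close>:
      its square gives \<open>l\<close> twice, the inner product once, so one positive factor
      \<open>l\<close> cancels.\<close>
    have "l * ((1 - k) * l * (norm (x - T x))\<^sup>2) \<le> l * (2 * ((x - y) \<bullet> (x - T x)))"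
      using k[OF that, of x] unfolding diff_averaged
      by (simp add: power_mult_distrib power2_eq_square mult_ac)
    then show ?thesis
      using \<open>l > 0\<close> by simp
  qed
  moreover have "1 - (1 - k) * l < 1"
    using \<open>k < 1\<close> \<open>l > 0\<close> by simp
  moreover have "Fix T \<noteq> {}"
    using assms(1) Fix by (simp add: demicontractive_def)
  ultimately show ?thesis
    unfolding demicontractive_def demicontractive_ineq_iff by blast
qed

lemma subset_enriched: "C \<subseteq> enriched C"
  \<comment> \<open>The witness is \<open>l = 1\<close>, where averaging leaves the map
    unchanged.\<close>
  unfolding enriched_def by (auto intro: bexI[of _ 1])

theorem theorem14:
  shows "saturated (C_DC :: ('h::{real_inner,complete_space} \<Rightarrow> 'h) set)"
  unfolding saturated_def
proof (rule equalityI[OF subset_enriched])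
  show "enriched C_DC \<subseteq> (C_DC :: ('h \<Rightarrow> 'h) set)"
    by (auto simp: enriched_def C_DC_def intro: demicontractive_averagedD)
qed

end
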